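(* Let $d\ge 2$ and let $E$ be a POVM with finitely many outcomes on $\mathbb{C}^d\otimes\mathbb{C}^d$ which determines whether a state is CC or not, i.e., there do not exist a CC state $\varrho_1$ and a state $\varrho_2$ that is not CC on $\mathbb{C}^d\otimes\mathbb{C}^d$ with $\mathrm{tr}[\varrho_1E_j]=\mathrm{tr}[\varrho_2E_j]$ for all outcomes $j$. Then $E$ is informationally complete.
   Context: A state on $\mathbb{C}^d\otimes\mathbb{C}^d$ is a positive semidefinite operator of trace one. A POVM with finitely many outcomes is a finite family $(E_j)$ of positive semidefinite operators on $\mathbb{C}^d\otimes\mathbb{C}^d$ with $\sum_j E_j=\mathbb{1}$; measuring it in the state $\varrho$ gives outcome $j$ with probability $\mathrm{tr}[\varrho E_j]$. Put $\mathcal{X}_E=\{\Delta \text{ Hermitian} \mid \mathrm{tr}[\Delta E_j]=0 \text{ for all } j\}$. $E$ is informationally complete if $\mathcal{X}_E=\{0\}$; equivalently, any two distinct states yield different outcome probabilities. A state is classical-classical (CC) if $\varrho=\sum_{i,j=1}^d c_{ij}|\phi_i\rangle\langle\phi_i|\otimes|\varphi_j\rangle\langle\varphi_j|$ for some orthonormal bases $\{|\phi_i\rangle\}_{i=1}^d$ and $\{|\varphi_j\rangle\}_{j=1}^d$ of $\mathbb{C}^d$ and $c_{ij}\ge0$, $\sum_{ij}c_{ij}=1$. *)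

theory Defs
  imports "HOL-Analysis.Analysis"
begin

text \<open>
  The space \<open>\<complex>\<^sup>d\<close> is \<open>complex ^ 'd\<close> with \<open>d = CARD('d)\<close>. The space \<open>\<complex>\<^sup>d \<otimes> \<complex>\<^sup>d\<close> is
  \<open>complex ^ ('d \<times> 'd)\<close>: the index \<open>(i, k)\<close> stands for the product basis vector \<open>e\<^sub>i \<otimes> e\<^sub>k\<close>,
  and operators are identified with their matrices in this basis.
\<close>

type_synonym 'n op = "complex ^ 'n ^ 'n"

text \<open>Conjugate-linear in the first argument; \<open>(\<bullet>)\<close> on \<open>complex ^ 'n\<close> is only the real part of this.\<close>

definition cinner :: "complex ^ 'n \<Rightarrow> complex ^ 'n \<Rightarrow> complex" where
  "cinner v w = (\<Sum>i\<in>UNIV. cnj (v $ i) * w $ i)"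

definition hermitian :: "('n::finite) op \<Rightarrow> bool" where
  "hermitian A \<longleftrightarrow> (\<forall>i j. A $ j $ i = cnj (A $ i $ j))"

text \<open>For Hermitian \<open>A\<close> the number \<open>cinner v (A *v v)\<close> is real, so \<open>Re\<close> loses nothing.\<close>

definition pos_semidef :: "('n::finite) op \<Rightarrow> bool" where
  "pos_semidef A \<longleftrightarrow> hermitian A \<and> (\<forall>v. 0 \<le> Re (cinner v (A *v v)))"

definition state :: "('n::finite) op \<Rightarrow> bool" where
  "state \<rho> \<longleftrightarrow> pos_semidef \<rho> \<and> trace \<rho> = 1"

definition povm :: "'j set \<Rightarrow> ('j \<Rightarrow> ('n::finite) op) \<Rightarrow> bool" where
  "povm J E \<longleftrightarrow> finite J \<and> (\<forall>j\<in>J. pos_semidef (E j)) \<and> (\<Sum>j\<in>J. E j) = mat 1"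

definition undetected :: "'j set \<Rightarrow> ('j \<Rightarrow> ('n::finite) op) \<Rightarrow> 'n op set" where
  "undetected J E = {\<Delta>. hermitian \<Delta> \<and> (\<forall>j\<in>J. trace (\<Delta> ** E j) = 0)}"

definition informationally_complete :: "'j set \<Rightarrow> ('j \<Rightarrow> ('n::finite) op) \<Rightarrow> bool" where
  "informationally_complete J E \<longleftrightarrow> undetected J E = {0}"

definition orthonormal_basis :: "('n \<Rightarrow> complex ^ ('n::finite)) \<Rightarrow> bool" where
  "orthonormal_basis \<phi> \<longleftrightarrow>
     (\<forall>i j. cinner (\<phi> i) (\<phi> j) = (if i = j then 1 else 0)) \<and> vec.span (range \<phi>) = UNIV"

text \<open>The operator \<open>|v\<rangle>\<langle>v|\<close>.\<close>

definition ketbra :: "complex ^ 'n \<Rightarrow> ('n::finite) op" where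
  "ketbra v = (\<chi> i j. v $ i * cnj (v $ j))"

definition tensor_op :: "('m::finite) op \<Rightarrow> ('n::finite) op \<Rightarrow> ('m \<times> 'n) op" where
  "tensor_op A B = (\<chi> p q. A $ fst p $ fst q * B $ snd p $ snd q)"

definition classical_classical :: "('d::finite \<times> 'd) op \<Rightarrow> bool" where
  "classical_classical \<rho> \<longleftrightarrow>
     (\<exists>(\<phi> :: 'd \<Rightarrow> complex ^ 'd) (\<psi> :: 'd \<Rightarrow> complex ^ 'd) (c :: 'd \<Rightarrow> 'd \<Rightarrow> real).
        orthonormal_basis \<phi> \<and> orthonormal_basis \<psi> \<and>
        (\<forall>i j. 0 \<le> c i j) \<and> (\<Sum>i\<in>UNIV. \<Sum>j\<in>UNIV. c i j) = 1 \<and>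
        \<rho> = (\<Sum>i\<in>UNIV. \<Sum>j\<in>UNIV. c i j *\<^sub>R tensor_op (ketbra (\<phi> i)) (ketbra (\<psi> j))))"

definition determines_CC :: "'j set \<Rightarrow> ('j \<Rightarrow> ('d::finite \<times> 'd) op) \<Rightarrow> bool" where
  "determines_CC J E \<longleftrightarrow>
     \<not> (\<exists>\<rho>\<^sub>1 \<rho>\<^sub>2. state \<rho>\<^sub>1 \<and> classical_classical \<rho>\<^sub>1 \<and>
                state \<rho>\<^sub>2 \<and> \<not> classical_classical \<rho>\<^sub>2 \<and>
                (\<forall>j\<in>J. trace (\<rho>\<^sub>1 ** E j) = trace (\<rho>\<^sub>2 ** E j)))"

end

theory Submission
  imports Defs
begin

text \<open>
  The blocks \<open>(\<rho>\<^bsub>(i,k),(j,l)\<^esub>)\<^sub>i\<^sub>j\<close> of a CC state, indexed by \<open>k\<close> and \<open>l\<close>, commute with each other, since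
  they are simultaneously diagonalised by the basis \<open>\<phi>\<close>. Let \<open>\<Delta>\<close> be undetected. The full-rank state
  \<open>(1 + |a\<rangle>\<langle>a| \<otimes> |e\<^sub>m\<rangle>\<langle>e\<^sub>m|) / (d\<^sup>2 + 1)\<close> is CC, so it stays CC under small multiples of \<open>\<Delta>\<close>. To first
  order, commutation of the blocks \<open>(k, l) \<noteq> (m, m)\<close> and \<open>(m, m)\<close> says that block \<open>(k, l)\<close> of \<open>\<Delta>\<close>
  commutes with \<open>|a\<rangle>\<langle>a|\<close>. Letting \<open>a\<close> vary, every block is scalar. With the two factors exchanged the
  same holds, so \<open>\<Delta>\<close> is a multiple of the identity, and its trace vanishes.
\<close>

section \<open>Hermitian and positive semidefinite operators\<close>

lemma hermitian_iff: "hermitian A \<longleftrightarrow> (\<forall>i j. cnj (A $ i $ j) = A $ j $ i)"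
  unfolding hermitian_def by metis

lemma hermitian_add: "hermitian A \<Longrightarrow> hermitian B \<Longrightarrow> hermitian (A + B)"
  by (simp add: hermitian_iff)

lemma hermitian_scaleR: "hermitian A \<Longrightarrow> hermitian (r *\<^sub>R A)"
  by (simp add: hermitian_iff)

lemma hermitian_mat_1: "hermitian (mat 1)"
  by (simp add: hermitian_def mat_def)

text \<open>Turns positivity into a condition on the real inner product, where Cauchy-Schwarz and
  operator norm bounds apply.\<close>

lemma Re_cinner: "Re (cinner v w) = v \<bullet> w"
  by (simp add: cinner_def inner_vec_def inner_complex_def)

lemma ketbra_mult_vec: "ketbra w *v v = cinner w v *s w"
  by (simp add: ketbra_def cinner_def matrix_vector_mult_def vec_eq_iff sum_distrib_left
      mult_ac)

lemma ketbra_mult: "ketbra v ** ketbra w = (\<chi> i j. cinner v w * (v $ i * cnj (w $ j)))"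
  by (simp add: ketbra_def cinner_def matrix_matrix_mult_def vec_eq_iff sum_distrib_left
      mult_ac)

text \<open>The quadratic form of \<open>ketbra w\<close> at v is the squared modulus of
  \<open>cinner w v\<close>.\<close>

lemma pos_semidef_ketbra: "pos_semidef (ketbra w)"
proof -
  have "cinner v w = cnj (cinner w v)" for v
    by (simp add: cinner_def mult.commute)
  moreover have "cinner v (ketbra w *v v) = cinner w v * cinner v w" for v
    unfolding ketbra_mult_vec by (simp add: cinner_def sum_distrib_left mult_ac)
  ultimately have "cinner v (ketbra w *v v) = of_real ((cmod (cinner w v))\<^sup>2)" for v
    by (metis complex_norm_square)
  then show ?thesis
    by (simp add: pos_semidef_def hermitian_def ketbra_def)
qed

lemma trace_scaleR: "trace (r *\<^sub>R (A :: ('n::finite) op)) = r *\<^sub>R trace A"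
  by (simp add: trace_def scaleR_sum_right)

lemma trace_ketbra: "trace (ketbra v) = cinner v v"
  by (simp add: trace_def ketbra_def cinner_def mult.commute)

lemma pos_semidef_scaleR:
  assumes "pos_semidef A" and "0 \<le> r"
  shows "pos_semidef (r *\<^sub>R A)"
proof -
  have "(r *\<^sub>R A) *v v = r *\<^sub>R (A *v v)" for v
    by (simp add: matrix_vector_mult_def vec_eq_iff scaleR_sum_right)
  then show ?thesis
    using assms by (simp add: pos_semidef_def hermitian_scaleR Re_cinner)
qed

definition tensor_vec :: "complex ^ 'm \<Rightarrow> complex ^ 'n \<Rightarrow> complex ^ ('m::finite \<times> 'n::finite)" where
  "tensor_vec v w = (\<chi> p. v $ fst p * w $ snd p)"

lemma tensor_op_ketbra: "tensor_op (ketbra v) (ketbra w) = ketbra (tensor_vec v w)"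
  by (simp add: tensor_op_def ketbra_def tensor_vec_def vec_eq_iff)

section \<open>Unitaries and the orthonormal bases formed by their columns\<close>

definition adjoint_op :: "('n::finite) op \<Rightarrow> 'n op" where
  "adjoint_op A = (\<chi> i j. cnj (A $ j $ i))"

definition unitary :: "('n::finite) op \<Rightarrow> bool" where
  "unitary U \<longleftrightarrow> adjoint_op U ** U = mat 1"

lemma unitary_right: "unitary U \<Longrightarrow> U ** adjoint_op U = mat 1"
  using matrix_left_right_inverse unfolding unitary_def by blast

text \<open>The Gram matrix of the columns is \<open>adjoint_op U ** U\<close>, and v = U (U* v)
  expands any v in the columns.\<close>

lemma orthonormal_basis_columns:
  assumes "unitary U"
  shows "orthonormal_basis (\<lambda>k. column k U)"
proof -
  have "cinner (column i U) (column j U) = (if i = j then 1 else 0)" for i j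
  proof -
    have "cinner (column i U) (column j U) = (adjoint_op U ** U) $ i $ j"
      by (simp add: cinner_def column_def adjoint_op_def matrix_matrix_mult_def)
    then show ?thesis
      using assms by (simp add: unitary_def mat_def)
  qed
  moreover have "v \<in> vec.span (range (\<lambda>k. column k U))" for v
  proof -
    have "v = U *v (adjoint_op U *v v)"
      by (simp add: matrix_vector_mul_assoc unitary_right[OF assms])
    also have "\<dots> \<in> vec.span (range (\<lambda>k. column k U))"
      unfolding matrix_mult_sum by (intro vec.span_sum vec.span_scale vec.span_base) auto
    finally show ?thesis .
  qed
  ultimately show ?thesis
    unfolding orthonormal_basis_def by auto
qed

lemma sum_ketbra_columns:
  assumes "unitary U"
  shows "(\<Sum>k\<in>UNIV. ketbra (column k U)) = mat 1"
  unfolding unitary_right[OF assms, symmetric]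
  by (simp add: ketbra_def column_def adjoint_op_def matrix_matrix_mult_def vec_eq_iff)

lemma unitary_mat_1: "unitary (mat 1 :: ('n::finite) op)"
proof -
  have "adjoint_op (mat 1) = (mat 1 :: 'n op)"
    by (simp add: adjoint_op_def mat_def vec_eq_iff)
  then show ?thesis by (simp add: unitary_def)
qed

lemma matrix_add_rdistrib: "(A + B) ** C = A ** C + B ** C"
  for A B :: "'a::semiring_1 ^ 'n ^ 'm"
  by (simp add: matrix_matrix_mult_def vec_eq_iff sum.distrib distrib_right)

text \<open>The reflection in the hyperplane orthogonal to w: it is self-adjoint, and it is an
  involution because \<open>ketbra w\<close> is a projection. It supplies an explicit basis other
  than the standard one.\<close>

lemma unitary_householder:
  assumes "cinner w w = 1"
  shows "unitary (mat 1 + (-2) *\<^sub>R ketbra w)"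
proof -
  let ?K = "ketbra w"
  have K: "?K ** ?K = ?K"
    unfolding ketbra_mult by (simp add: assms ketbra_def)
  have "(mat 1 + (-2) *\<^sub>R ?K) ** (mat 1 + (-2) *\<^sub>R ?K)
      = mat 1 + (-2) *\<^sub>R ?K + ((-2) *\<^sub>R ?K + 4 *\<^sub>R (?K ** ?K))"
    unfolding matrix_add_ldistrib matrix_add_rdistrib matrix_scalar_ac scalar_matrix_assoc[symmetric]
    by (simp add: algebra_simps)
  then have "(mat 1 + (-2) *\<^sub>R ?K) ** (mat 1 + (-2) *\<^sub>R ?K) = mat 1"
    unfolding K by (simp add: add.assoc flip: scaleR_add_left)
  moreover have "adjoint_op (mat 1 + (-2) *\<^sub>R ?K) = mat 1 + (-2) *\<^sub>R ?K"
    by (simp add: adjoint_op_def ketbra_def mat_def vec_eq_iff)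
  ultimately show ?thesis by (simp add: unitary_def)
qed

section \<open>Blocks of an operator and their commutation for CC states\<close>

definition block :: "'n \<Rightarrow> 'n \<Rightarrow> ('m::finite \<times> 'n::finite) op \<Rightarrow> 'm op" where
  "block k l \<rho> = (\<chi> i j. \<rho> $ (i, k) $ (j, l))"

lemma block_add: "block k l (A + B) = block k l A + block k l B"
  by (simp add: block_def vec_eq_iff)

lemma block_scaleR: "block k l (r *\<^sub>R A) = r *\<^sub>R block k l A"
  by (simp add: block_def vec_eq_iff)

text \<open>Operators diagonal in the basis \<phi> multiply by multiplying their eigenvalues, since
  the projections onto the basis vectors are mutually orthogonal.\<close>

lemma ketbra_combination_mult:
  assumes "orthonormal_basis \<phi>"
  shows "(\<chi> p q. \<Sum>i\<in>UNIV. f i * ketbra (\<phi> i) $ p $ q) ** (\<chi> p q. \<Sum>i\<in>UNIV. g i * ketbra (\<phi> i) $ p $ q)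
       = (\<chi> p q. \<Sum>i\<in>UNIV. f i * g i * ketbra (\<phi> i) $ p $ q)"
proof -
  have "(\<Sum>r\<in>UNIV. (\<Sum>i\<in>UNIV. f i * ketbra (\<phi> i) $ p $ r) * (\<Sum>j\<in>UNIV. g j * ketbra (\<phi> j) $ r $ q))
      = (\<Sum>i\<in>UNIV. f i * g i * ketbra (\<phi> i) $ p $ q)" for p q
  proof -
    have orth: "(\<Sum>r\<in>UNIV. cnj (\<phi> i $ r) * \<phi> j $ r) = (if i = j then 1 else 0)" for i j
      using assms by (simp add: orthonormal_basis_def cinner_def)
    have "(\<Sum>r\<in>UNIV. (\<Sum>i\<in>UNIV. f i * ketbra (\<phi> i) $ p $ r) * (\<Sum>j\<in>UNIV. g j * ketbra (\<phi> j) $ r $ q))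
       = (\<Sum>r\<in>UNIV. \<Sum>i\<in>UNIV. \<Sum>j\<in>UNIV.
            f i * g j * \<phi> i $ p * cnj (\<phi> j $ q) * (cnj (\<phi> i $ r) * \<phi> j $ r))"
      by (simp add: sum_product ketbra_def mult_ac)
    \<comment> \<open>The sum over r becomes the innermost one, where it is the inner product of
      \<open>\<phi> i\<close> and \<open>\<phi> j\<close>.\<close>
    also have "\<dots> = (\<Sum>i\<in>UNIV. \<Sum>j\<in>UNIV. \<Sum>r\<in>UNIV.
            f i * g j * \<phi> i $ p * cnj (\<phi> j $ q) * (cnj (\<phi> i $ r) * \<phi> j $ r))"
      by (subst sum.swap) (intro sum.cong refl sum.swap)
    also have "\<dots> = (\<Sum>i\<in>UNIV. \<Sum>j\<in>UNIV. f i * g j * \<phi> i $ p * cnj (\<phi> j $ q) * (if i = j then 1 else 0))"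
      by (simp only: orth flip: sum_distrib_left)
    also have "\<dots> = (\<Sum>i\<in>UNIV. f i * g i * ketbra (\<phi> i) $ p $ q)"
      by (simp add: ketbra_def mult_ac if_distrib cong: if_cong)
    finally show ?thesis .
  qed
  then show ?thesis
    by (simp add: matrix_matrix_mult_def vec_eq_iff)
qed

text \<open>A block of a product operator is its first factor times an entry of the second. Hence
  every block is diagonal in the same basis \<phi>, with eigenvalues \<open>f k l i\<close>.\<close>

lemma classical_classical_blocks_commute:
  assumes "classical_classical \<rho>"
  shows "block k l \<rho> ** block m n \<rho> = block m n \<rho> ** block k l \<rho>"
proof -
  obtain \<phi> \<psi> :: "'a \<Rightarrow> complex ^ 'a" and c :: "'a \<Rightarrow> 'a \<Rightarrow> real"
    where ob: "orthonormal_basis \<phi>"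
      and rho: "\<rho> = (\<Sum>i\<in>UNIV. \<Sum>j\<in>UNIV. c i j *\<^sub>R tensor_op (ketbra (\<phi> i)) (ketbra (\<psi> j)))"
    using assms unfolding classical_classical_def by blast
  define f where "f k l i = (\<Sum>j\<in>UNIV. c i j *\<^sub>R ketbra (\<psi> j) $ k $ l)" for k l i
  have block: "block k l \<rho> = (\<chi> p q. \<Sum>i\<in>UNIV. f k l i * ketbra (\<phi> i) $ p $ q)" for k l
    by (simp add: rho block_def f_def vec_eq_iff tensor_op_def sum_distrib_left sum_distrib_right
      mult_ac)
  show ?thesis
    unfolding block ketbra_combination_mult[OF ob] by (simp add: mult.commute)
qed

section \<open>Exchange of the two tensor factors\<close>

definition swap_op :: "('m::finite \<times> 'n::finite) op \<Rightarrow> ('n \<times> 'm) op" where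
  "swap_op A = (\<chi> p q. A $ prod.swap p $ prod.swap q)"

lemma sum_swap: "(\<Sum>p\<in>UNIV. f (prod.swap p)) = (\<Sum>p\<in>UNIV. f (p :: 'a::finite \<times> 'b::finite))"
  by (rule sum.reindex_bij_witness[of _ prod.swap prod.swap]) auto

lemma swap_op_swap_op [simp]: "swap_op (swap_op A) = A"
  by (simp add: swap_op_def vec_eq_iff)

lemma hermitian_swap_op: "hermitian A \<Longrightarrow> hermitian (swap_op A)"
  by (simp add: hermitian_iff swap_op_def)

lemma trace_swap_op: "trace (swap_op A) = trace A"
  using sum_swap[of "\<lambda>p. A $ p $ p"] by (simp add: trace_def swap_op_def)

text \<open>The exchange permutes the product basis, so the quadratic form of
  \<open>swap_op \<rho>\<close> at v is that of \<rho> at the permuted vector.\<close>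

lemma state_swap_op:
  assumes "state \<rho>"
  shows "state (swap_op \<rho>)"
proof -
  have "cinner v (swap_op \<rho> *v v) = cinner (\<chi> p. v $ prod.swap p) (\<rho> *v (\<chi> p. v $ prod.swap p))" for v
  proof -
    have inner: "(swap_op \<rho> *v v) $ p = (\<rho> *v (\<chi> p. v $ prod.swap p)) $ prod.swap p" for p
      using sum_swap[of "\<lambda>q. \<rho> $ prod.swap p $ q * v $ prod.swap q"]
      by (simp add: matrix_vector_mult_def swap_op_def)
    show ?thesis
      using sum_swap[of "\<lambda>p. cnj (v $ prod.swap p) * (\<rho> *v (\<chi> p. v $ prod.swap p)) $ p"]
      by (simp add: cinner_def inner)
  qed
  then show ?thesis
    using assms by (simp add: state_def pos_semidef_def hermitian_swap_op trace_swap_op)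
qed

lemma classical_classical_swap_op:
  assumes "classical_classical \<rho>"
  shows "classical_classical (swap_op \<rho>)"
proof -
  obtain \<phi> \<psi> :: "'a \<Rightarrow> complex ^ 'a" and c :: "'a \<Rightarrow> 'a \<Rightarrow> real"
    where ob: "orthonormal_basis \<phi>" "orthonormal_basis \<psi>"
      and c: "\<forall>i j. 0 \<le> c i j" "(\<Sum>i\<in>UNIV. \<Sum>j\<in>UNIV. c i j) = 1"
      and rho: "\<rho> = (\<Sum>i\<in>UNIV. \<Sum>j\<in>UNIV. c i j *\<^sub>R tensor_op (ketbra (\<phi> i)) (ketbra (\<psi> j)))"
    using assms unfolding classical_classical_def by blast
  have "swap_op \<rho> = (\<Sum>i\<in>UNIV. \<Sum>j\<in>UNIV. c i j *\<^sub>R tensor_op (ketbra (\<psi> j)) (ketbra (\<phi> i)))"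
    by (simp add: rho swap_op_def tensor_op_def vec_eq_iff mult_ac)
  also have "\<dots> = (\<Sum>j\<in>UNIV. \<Sum>i\<in>UNIV. c i j *\<^sub>R tensor_op (ketbra (\<psi> j)) (ketbra (\<phi> i)))"
    by (rule sum.swap)
  finally have "swap_op \<rho> = \<dots>" .
  moreover have "(\<Sum>j\<in>UNIV. \<Sum>i\<in>UNIV. c i j) = 1"
    using c(2) by (subst sum.swap)
  ultimately show ?thesis
    unfolding classical_classical_def using ob c(1)
    by (intro exI[of _ \<psi>] exI[of _ \<phi>] exI[of _ "\<lambda>j i. c i j"]) auto
qed

section \<open>Directions along which CC states stay CC\<close>

definition CC_direction :: "('d::finite \<times> 'd) op \<Rightarrow> bool" where
  "CC_direction \<Delta> \<longleftrightarrow> (\<forall>\<rho> (t::real). state \<rho> \<longrightarrow> classical_classical \<rho> \<longrightarrow>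
     state (\<rho> + t *\<^sub>R \<Delta>) \<longrightarrow> classical_classical (\<rho> + t *\<^sub>R \<Delta>))"

text \<open>Allows results about blocks, which act on the first factor, to be transferred to the
  second factor.\<close>

lemma CC_direction_swap_op:
  assumes "CC_direction \<Delta>"
  shows "CC_direction (swap_op \<Delta>)"
  unfolding CC_direction_def
proof (intro allI impI)
  fix \<rho> :: "('a \<times> 'a) op" and t :: real
  assume "state \<rho>" "classical_classical \<rho>" "state (\<rho> + t *\<^sub>R swap_op \<Delta>)"
  moreover have sw: "swap_op (A + t *\<^sub>R B) = swap_op A + t *\<^sub>R swap_op B" for A B :: "('a \<times> 'a) op"
    by (simp add: swap_op_def vec_eq_iff)
  ultimately have "classical_classical (swap_op \<rho> + t *\<^sub>R \<Delta>)"
    using assms state_swap_op[of \<rho>] state_swap_op[of "\<rho> + t *\<^sub>R swap_op \<Delta>"]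
      classical_classical_swap_op[of \<rho>]
    unfolding CC_direction_def by simp
  then show "classical_classical (\<rho> + t *\<^sub>R swap_op \<Delta>)"
    using classical_classical_swap_op sw by fastforce
qed

text \<open>The form of \<open>mat 1 + Q\<close> at v is at least the squared norm of v, which
  dominates that of t \<Delta> once |t| times a norm bound for \<Delta> is at most 1.\<close>

lemma pos_semidef_perturb:
  assumes "hermitian \<Delta>" and "pos_semidef Q"
  obtains e :: real where "e > 0" "\<And>t. \<bar>t\<bar> \<le> e \<Longrightarrow> pos_semidef (mat 1 + Q + t *\<^sub>R \<Delta>)"
proof -
  \<comment> \<open>The bound K is strictly positive even for \<Delta> = 0, so
    \<open>inverse K\<close> can serve as e.\<close>
  obtain K where K: "K > 0" "\<And>v. norm (\<Delta> *v v) \<le> norm v * K"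
    using bounded_linear.pos_bounded[OF matrix_vector_mul_bounded_linear] by blast
  have "pos_semidef (mat 1 + Q + t *\<^sub>R \<Delta>)" if t: "\<bar>t\<bar> \<le> inverse K" for t
  proof -
    have "0 \<le> v \<bullet> ((mat 1 + Q + t *\<^sub>R \<Delta>) *v v)" for v
    proof -
      have "\<bar>v \<bullet> (\<Delta> *v v)\<bar> \<le> norm v * (norm v * K)"
        using Cauchy_Schwarz_ineq2[of v "\<Delta> *v v"] K(2)[of v]
        by (meson mult_left_mono norm_ge_zero order_trans)
      then have "\<bar>t * (v \<bullet> (\<Delta> *v v))\<bar> \<le> inverse K * (norm v * (norm v * K))"
        unfolding abs_mult using t K(1) by (intro mult_mono) auto
      also have "\<dots> = v \<bullet> v"
        using K(1) by (simp add: dot_square_norm power2_eq_square)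
      finally have "0 \<le> v \<bullet> v + t * (v \<bullet> (\<Delta> *v v))" by linarith
      moreover have "0 \<le> v \<bullet> (Q *v v)"
        using assms(2) by (simp add: pos_semidef_def Re_cinner)
      moreover have "(t *\<^sub>R \<Delta>) *v v = t *\<^sub>R (\<Delta> *v v)"
        by (simp add: matrix_vector_mult_def vec_eq_iff scaleR_sum_right)
      ultimately show ?thesis
        by (simp add: matrix_vector_mult_add_rdistrib inner_add_right)
    qed
    moreover have "hermitian (mat 1 + Q + t *\<^sub>R \<Delta>)"
      using assms by (simp add: pos_semidef_def hermitian_add hermitian_scaleR hermitian_mat_1)
    ultimately show ?thesis
      by (simp add: pos_semidef_def Re_cinner)
  qed
  with K(1) that[of "inverse K"] show thesis by simp
qed

text \<open>The identity is the sum of all product projections of the two column bases. The weights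
  are thus 1, except 2 at (a, b); they add up to d^2 + 1, which \<kappa> normalises.\<close>

lemma classical_classical_columns:
  fixes U V :: "('d::finite) op"
  assumes U: "unitary U" and V: "unitary V"
  defines "\<kappa> \<equiv> inverse (real (CARD('d \<times> 'd) + 1))"
  shows "classical_classical
    (\<kappa> *\<^sub>R (mat 1 + tensor_op (ketbra (column a U)) (ketbra (column b V))))"
proof -
  have "0 < 1 + real CARD('d) * real CARD('d)"
    by (simp add: add_pos_nonneg)
  define P where "P i = ketbra (column i U)" for i
  define Q where "Q j = ketbra (column j V)" for j
  define c where "c i j = \<kappa> * (1 + (if j = b then if i = a then 1 else 0 else 0))" for i j :: 'd
  have "(\<Sum>i\<in>UNIV. \<Sum>j\<in>UNIV. tensor_op (P i) (Q j)) = tensor_op (\<Sum>i\<in>UNIV. P i) (\<Sum>j\<in>UNIV. Q j)"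
    by (simp add: tensor_op_def vec_eq_iff sum_product)
  also have "\<dots> = mat 1"
    unfolding P_def Q_def sum_ketbra_columns[OF U] sum_ketbra_columns[OF V]
    by (auto simp: tensor_op_def mat_def vec_eq_iff)
  finally have one: "(\<Sum>i\<in>UNIV. \<Sum>j\<in>UNIV. tensor_op (P i) (Q j)) = mat 1" .
  have "(\<Sum>i\<in>UNIV. \<Sum>j\<in>UNIV. (if j = b then if i = a then 1 else 0 else 0) *\<^sub>R tensor_op (P i) (Q j))
     = (\<Sum>i\<in>UNIV. \<Sum>j\<in>UNIV. if j = b then if i = a then tensor_op (P i) (Q j) else 0 else 0)"
    by (intro sum.cong refl) auto
  also have "\<dots> = tensor_op (P a) (Q b)"
    by simp
  finally have "(\<Sum>i\<in>UNIV. \<Sum>j\<in>UNIV. c i j *\<^sub>R tensor_op (P i) (Q j))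
      = \<kappa> *\<^sub>R (mat 1 + tensor_op (P a) (Q b))"
    unfolding c_def scaleR_scaleR[symmetric] scaleR_sum_right[symmetric] scaleR_add_left
      sum.distrib scaleR_one one by simp
  moreover have "(\<Sum>i\<in>UNIV. \<Sum>j\<in>UNIV. c i j) = 1"
    unfolding c_def sum_distrib_left[symmetric] sum.distrib
    using \<open>0 < 1 + real CARD('d) * real CARD('d)\<close> by (simp add: \<kappa>_def field_simps)
  moreover have "0 \<le> c i j" for i j
    by (simp add: c_def \<kappa>_def)
  ultimately show ?thesis
    unfolding classical_classical_def P_def Q_def
    using orthonormal_basis_columns[OF U] orthonormal_basis_columns[OF V]
    by (intro exI[of _ "\<lambda>i. column i U"] exI[of _ "\<lambda>j. column j V"] exI[of _ c]) auto
qed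

lemma CC_direction_commute:
  fixes \<Delta> :: "('d::finite \<times> 'd) op"
  assumes CC: "CC_direction \<Delta>" and herm: "hermitian \<Delta>" and tr: "trace \<Delta> = 0"
    and U: "unitary U" and kl: "(k, l) \<noteq> (m, m)"
  shows "block k l \<Delta> ** ketbra (column a U) = ketbra (column a U) ** block k l \<Delta>"
proof -
  define P where "P = ketbra (column a U)"
  \<comment> \<open>\<open>column m (mat 1)\<close> is the standard basis vector e_m, so (m, m) is
    the only nonzero block of Q, and it equals P.\<close>
  define Q where "Q = tensor_op P (ketbra (column m (mat 1)))"
  define \<kappa> where "\<kappa> = inverse (real (CARD('d \<times> 'd) + 1))"
  have \<kappa>: "\<kappa> > 0"
    unfolding \<kappa>_def by (intro inverse_positive_iff_positive[THEN iffD2] of_nat_0_less_iff[THEN iffD2]) simp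
  have psd: "pos_semidef Q"
    by (simp add: Q_def P_def tensor_op_ketbra pos_semidef_ketbra)
  obtain e where e: "e > 0" "\<And>t. \<bar>t\<bar> \<le> e \<Longrightarrow> pos_semidef (mat 1 + Q + t *\<^sub>R \<Delta>)"
    using pos_semidef_perturb[OF herm psd] by blast
  have "trace Q = trace P * trace (ketbra (column m (mat 1)))"
    by (simp add: Q_def tensor_op_def trace_def sum_product sum.cartesian_product flip: UNIV_Times_UNIV)
       (simp add: case_prod_unfold)
  then have "trace Q = 1"
    using orthonormal_basis_columns[OF U] orthonormal_basis_columns[OF unitary_mat_1[where 'n = 'd]]
    by (simp add: P_def trace_ketbra orthonormal_basis_def)
  \<comment> \<open>The identity contributes d^2, Q contributes 1 and \<Delta> nothing, for every
    t.\<close>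
  then have "trace (mat 1 + Q + t *\<^sub>R \<Delta>) = of_real (inverse \<kappa>)" for t
    by (simp add: trace_scaleR trace_add tr trace_I \<kappa>_def)
  then have "trace (\<kappa> *\<^sub>R (mat 1 + Q + t *\<^sub>R \<Delta>)) = 1" for t
    using \<kappa> unfolding trace_scaleR by (metis scaleR_conv_of_real of_real_mult of_real_1
        right_inverse less_numeral_extra(3))
  then have state: "state (\<kappa> *\<^sub>R (mat 1 + Q + t *\<^sub>R \<Delta>))" if "\<bar>t\<bar> \<le> e" for t
    using pos_semidef_scaleR[OF e(2)[OF that], of \<kappa>] \<kappa> by (simp add: state_def)
  have cc: "classical_classical (\<kappa> *\<^sub>R (mat 1 + Q))"
    unfolding \<kappa>_def Q_def P_def by (rule classical_classical_columns[OF U unitary_mat_1])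
  have comm: "block k l (mat 1 + Q + t *\<^sub>R \<Delta>) ** block m m (mat 1 + Q + t *\<^sub>R \<Delta>)
      = block m m (mat 1 + Q + t *\<^sub>R \<Delta>) ** block k l (mat 1 + Q + t *\<^sub>R \<Delta>)" if "\<bar>t\<bar> \<le> e" for t
  proof -
    let ?A = "mat 1 + Q + t *\<^sub>R \<Delta>"
    have "state (\<kappa> *\<^sub>R (mat 1 + Q))"
      using state[of 0] e(1) by simp
    \<comment> \<open>The perturbed state is reached from the CC state by a step of length \<kappa>
      t along \<Delta>.\<close>
    moreover have "\<kappa> *\<^sub>R (mat 1 + Q) + (\<kappa> * t) *\<^sub>R \<Delta> = \<kappa> *\<^sub>R ?A"
      by (simp add: scaleR_add_right)
    ultimately have "classical_classical (\<kappa> *\<^sub>R ?A)"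
      using CC cc state[OF that] unfolding CC_direction_def by metis
    from classical_classical_blocks_commute[OF this, of k l m m] show ?thesis
      using \<kappa> by (simp add: block_scaleR scalar_matrix_assoc[symmetric] matrix_scalar_ac)
  qed
  define D where "D = block k l \<Delta>"
  define D' where "D' = block m m \<Delta>"
  define \<delta> where "\<delta> = (if k = l then 1 else 0 :: real)"
  have kl_block: "block k l (mat 1 + Q) = \<delta> *\<^sub>R mat 1"
    using kl by (auto simp: block_def Q_def tensor_op_def ketbra_def column_def mat_def vec_eq_iff \<delta>_def)
  have mm_block: "block m m (mat 1 + Q) = mat 1 + P"
    by (auto simp: block_def Q_def tensor_op_def ketbra_def column_def mat_def vec_eq_iff)
  \<comment> \<open>The blocks are \<delta> 1 + t D and 1 + P + t D'. Multiples of the identity drop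
    out of their commutator, leaving t [D, P] + t^2 [D, D'] = 0.\<close>
  have lin: "t *\<^sub>R (D ** P) + (t * t) *\<^sub>R (D ** D') = t *\<^sub>R (P ** D) + (t * t) *\<^sub>R (D' ** D)"
    if "\<bar>t\<bar> \<le> e" for t
    using comm[OF that]
    unfolding block_add[of _ _ "mat 1 + Q"] block_scaleR kl_block mm_block D_def[symmetric] D'_def[symmetric]
    by (simp add: matrix_add_ldistrib matrix_add_rdistrib scalar_matrix_assoc[symmetric]
        matrix_scalar_ac algebra_simps)
  have "(2 * e) *\<^sub>R (D ** P) = (2 * e) *\<^sub>R (P ** D)"
  proof -
    \<comment> \<open>Subtracting the instances \<open>t = e\<close> and \<open>t = - e\<close> cancels the quadratic terms.\<close>
    have "(e *\<^sub>R (D ** P) + (e * e) *\<^sub>R (D ** D')) - (- e *\<^sub>R (D ** P) + (- e * - e) *\<^sub>R (D ** D'))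
        = (e *\<^sub>R (P ** D) + (e * e) *\<^sub>R (D' ** D)) - (- e *\<^sub>R (P ** D) + (- e * - e) *\<^sub>R (D' ** D))"
      using lin[of e] lin[of "- e"] e(1) by simp
    then show ?thesis
      unfolding mult_2 scaleR_add_left by simp
  qed
  then show ?thesis
    using e(1) by (simp add: D_def P_def)
qed

text \<open>A block commuting with every |e_q><e_q| is diagonal; commuting also with a projection
  that mixes e_i and e_j forces its diagonal entries at i and j to agree.\<close>

lemma CC_direction_block:
  fixes \<Delta> :: "('d::finite \<times> 'd) op"
  assumes \<Delta>: "CC_direction \<Delta>" "hermitian \<Delta>" "trace \<Delta> = 0"
    and "i \<noteq> j"
  shows "\<Delta> $ (i, k) $ (j, l) = 0" and "\<Delta> $ (i, k) $ (i, l) = \<Delta> $ (j, k) $ (j, l)"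
proof -
  \<comment> \<open>Two distinct indices exist, so some m differs from k, which makes commutation
    available for block (k, l).\<close>
  obtain m :: 'd where "m \<noteq> k"
    using \<open>i \<noteq> j\<close> by metis
  then have m: "(k, l) \<noteq> (m, m)" by simp
  note comm = CC_direction_commute[OF \<Delta> _ m]
  define D where "D = block k l \<Delta>"
  \<comment> \<open>At entry (p, q), D |e_q><e_q| gives \<open>D $ p $ q\<close>, while |e_q><e_q| D
    gives 0.\<close>
  have diag: "D $ p $ q = 0" if "p \<noteq> q" for p q
  proof -
    have "(D ** ketbra (column q (mat 1))) $ p $ q = (ketbra (column q (mat 1)) ** D) $ p $ q"
      using comm[OF unitary_mat_1] by (simp add: D_def)
    moreover have "ketbra (column q (mat 1)) $ a $ b = (if a = q then if b = q then 1 else 0 else 0)"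
      for a b
      by (simp add: ketbra_def column_def mat_def)
    ultimately show ?thesis
      using that by (simp add: matrix_matrix_mult_def mult_delta_right)
  qed
  show "\<Delta> $ (i, k) $ (j, l) = 0"
    using diag[OF \<open>i \<noteq> j\<close>] by (simp add: D_def block_def)
  \<comment> \<open>Column i of the reflection is e_i - (6/5) w = (7/25) e_i - (24/25) e_j. Both
    coefficients are nonzero, hence so is \<open>P $ i $ j\<close>; equal weights in w would send
    e_i to -e_j and make it vanish.\<close>
  define w where "w = (\<chi> p. if p = i then 3/5 else if p = j then 4/5 else (0::complex))"
  have "cinner w w = (\<Sum>p\<in>{i, j}. cnj (w $ p) * w $ p)"
    unfolding cinner_def by (rule sum.mono_neutral_right) (auto simp: w_def)
  then have "cinner w w = 1"
    using \<open>i \<noteq> j\<close> by (simp add: w_def)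
  note U = unitary_householder[OF this]
  define P where "P = ketbra (column i (mat 1 + (-2) *\<^sub>R ketbra w))"
  have "P $ i $ j \<noteq> 0"
    using \<open>i \<noteq> j\<close> by (simp add: P_def ketbra_def column_def mat_def w_def scaleR_conv_of_real)
  \<comment> \<open>Entry (i, j) of D P = P D, with D diagonal, equates D_ii P_ij and P_ij
    D_jj.\<close>
  have "D $ i $ i * P $ i $ j = (\<Sum>r\<in>{i}. D $ i $ r * P $ r $ j)"
    by simp
  also have "\<dots> = (D ** P) $ i $ j"
    unfolding matrix_matrix_mult_def vec_lambda_beta
    by (rule sum.mono_neutral_left) (auto simp: diag)
  also have "\<dots> = (P ** D) $ i $ j"
    using comm[OF U] by (simp add: D_def P_def)
  also have "\<dots> = (\<Sum>r\<in>{j}. P $ i $ r * D $ r $ j)"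
    unfolding matrix_matrix_mult_def vec_lambda_beta
    by (rule sum.mono_neutral_right) (auto simp: diag)
  finally have "D $ i $ i = D $ j $ j"
    using \<open>P $ i $ j \<noteq> 0\<close> by simp
  then show "\<Delta> $ (i, k) $ (i, l) = \<Delta> $ (j, k) $ (j, l)"
    by (simp add: D_def block_def)
qed

section \<open>Undetected operators vanish\<close>

lemma trace_mult_sum_right: "trace (A ** (\<Sum>j\<in>J. B j)) = (\<Sum>j\<in>J. trace (A ** B j))"
  for A :: "('n::finite) op"
proof -
  have "trace (A ** 0) = 0"
    by (simp add: matrix_matrix_mult_def trace_def)
  then show ?thesis
    by (induction J rule: infinite_finite_induct) (simp_all add: matrix_add_ldistrib trace_add)
qed

theorem corollary4:
  fixes J :: "'j set" and E :: "'j \<Rightarrow> ('d::finite \<times> 'd) op"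
  assumes "CARD('d) \<ge> 2"
    and "povm J E"
    and "determines_CC J E"
  shows "informationally_complete J E"
proof -
  have "\<Delta> = 0" if "\<Delta> \<in> undetected J E" for \<Delta>
  proof -
    have herm: "hermitian \<Delta>" and E: "\<And>j. j \<in> J \<Longrightarrow> trace (\<Delta> ** E j) = 0"
      using that by (auto simp: undetected_def)
    \<comment> \<open>The effects sum to the identity, so the trace is a sum of undetected
      probabilities.\<close>
    have "trace \<Delta> = trace (\<Delta> ** (\<Sum>j\<in>J. E j))"
      using assms(2) by (simp add: povm_def)
    also have "\<dots> = (\<Sum>j\<in>J. trace (\<Delta> ** E j))"
      by (rule trace_mult_sum_right)
    finally have tr: "trace \<Delta> = 0"
      by (simp add: E)
    \<comment> \<open>Moving along \<Delta> changes no outcome probability, so a measurement that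
      determines CC cannot let the move leave the CC states.\<close>
    have "trace ((\<rho> + t *\<^sub>R \<Delta>) ** E j) = trace (\<rho> ** E j)" if "j \<in> J" for j t \<rho>
      using E[OF that]
      by (simp add: matrix_add_rdistrib trace_add scalar_matrix_assoc[symmetric] trace_scaleR)
    then have CC: "CC_direction \<Delta>"
      using assms(3) unfolding CC_direction_def determines_CC_def by metis
    have "swap_op \<Delta> $ (k, i) $ (l, j) = \<Delta> $ (i, k) $ (j, l)" for i j k l
      by (simp add: swap_op_def)
    moreover have "hermitian (swap_op \<Delta>)" "trace (swap_op \<Delta>) = 0"
      using herm tr by (simp_all add: hermitian_swap_op trace_swap_op)
    ultimately have B: "k \<noteq> l \<Longrightarrow> \<Delta> $ (i, k) $ (j, l) = 0"
        "k \<noteq> l \<Longrightarrow> \<Delta> $ (i, k) $ (j, k) = \<Delta> $ (i, l) $ (j, l)" for i j k l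
      using CC_direction_block[OF CC_direction_swap_op[OF CC]] by metis+
    note A = CC_direction_block[OF CC herm tr]
    \<comment> \<open>Distinct index pairs differ in the first component, covered by A, or in the
      second, covered by B.\<close>
    have off: "\<Delta> $ p $ q = 0" if "p \<noteq> q" for p q
      using that A(1) B(1) by (cases p; cases q) auto
    have diag: "\<Delta> $ p $ p = \<Delta> $ q $ q" for p q
    proof -
      obtain i k j l where pq: "p = (i, k)" "q = (j, l)"
        by (cases p; cases q)
      \<comment> \<open>Change the first index with A, then the second with B.\<close>
      have "\<Delta> $ (i, k) $ (i, k) = \<Delta> $ (j, k) $ (j, k)"
        using A(2)[of i j k k] by (cases "i = j") auto
      also have "\<dots> = \<Delta> $ (j, l) $ (j, l)"
        using B(2)[of k l j j] by (cases "k = l") auto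
      finally show ?thesis
        by (simp add: pq)
    qed
    have "\<Delta> $ p $ p = 0" for p
    proof -
      \<comment> \<open>All diagonal entries agree, so the vanishing trace is d^2 times their common
        value.\<close>
      have "trace \<Delta> = of_nat CARD('d \<times> 'd) * \<Delta> $ p $ p"
        unfolding trace_def by (subst diag[of _ p]) simp
      then show ?thesis
        using tr by simp
    qed
    then have "\<Delta> $ p $ q = 0" for p q
      using off by (cases "p = q") auto
    then show "\<Delta> = 0"
      by (simp add: vec_eq_iff)
  qed
  then show ?thesis
    by (auto simp: informationally_complete_def undetected_def hermitian_def matrix_matrix_mult_def trace_def)
qed

end
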